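(* Let $\mathcal{F}$ be a 2-construction scheme and for $\alpha\in\omega_1$ let $L_\alpha=\{2k+\Xi_\alpha(k): k\in\omega\setminus 1,\ \Xi_\alpha(k)\ge 0\}$ and $R_\alpha=\{2k+(1-\Xi_\alpha(k)): k\in\omega\setminus 1,\ \Xi_\alpha(k)\ge0\}$. Then the gap $(L_\alpha,R_\alpha)_{\alpha\in\omega_1}$ is levelwise-separable; that is, there is $C\subseteq\omega$ such that $(L_{\alpha+1}\setminus L_\alpha)\setminus C$ and $C\cap(R_{\alpha+1}\setminus R_\alpha)$ are finite for every $\alpha\in\omega_1$.
   Context: A type is a sequence $\tau=\langle m_k,n_{k+1},r_{k+1}\rangle_{k\in\omega}$ of natural numbers with $m_0=1$, $n_{k+1}\ge2$, $m_k>r_{k+1}$, $m_{k+1}=r_{k+1}+(m_k-r_{k+1})n_{k+1}$; it is good if for every $r\in\omega$ there are infinitely many $k$ with $r_k=r$ (all types are assumed good). A construction scheme of type $\tau$ is a family $\mathcal{F}$ of nonempty finite subsets of $\omega_1$, cofinal in the finite subsets of $\omega_1$ under $\subseteq$, each of cardinality $m_k$ for some $k$, such that, writing $\mathcal{F}_k=\{F\in\mathcal{F}:|F|=m_k\}$: (i) for $E,F\in\mathcal{F}_k$, $E\cap F$ is an initial segment of both; (ii) every $F\in\mathcal{F}_{k+1}$ is a union $F_0\cup\dots\cup F_{n_{k+1}-1}$ of members of $\mathcal{F}_k$ forming a $\Delta$-system with root $R(F)$, $|R(F)|=r_{k+1}$, $R(F)<F_0\setminus R(F)<\dots<F_{n_{k+1}-1}\setminus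 R(F)$. A 2-construction scheme is one whose type has $n_{k+1}=2$ for all $k$. For $\alpha\in\omega_1$: $\Xi_\alpha(0)=0$, and for $k\ge1$ take $F\in\mathcal{F}_k$ with $\alpha\in F$ and let $\Xi_\alpha(k)=-1$ if $\alpha\in R(F)$, $\Xi_\alpha(k)=i$ if $\alpha\in F_i\setminus R(F)$ (independent of the choice of $F$). (It is known that $(L_\alpha,R_\alpha)_{\alpha\in\omega_1}$ is a $\subseteq^*$-increasing gap.) An $(\omega_1,\omega_1)$-gap is levelwise-separable if the pregap $(L_{\alpha+1}\setminus L_\alpha,R_{\alpha+1}\setminus R_\alpha)_{\alpha\in\omega_1}$ is not a gap, i.e. can be separated. *)

theory Defs
  imports "HOL-Analysis.Analysis"
begin

section \<open>The first uncountable ordinal\<close>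

typedef omega1 = "Field (cardSuc natLeq)"
  using Field_cardSuc_not_empty[OF natLeq_Card_order] by blast

lemma omega1_well_order: "well_order_on (Field (cardSuc natLeq)) (cardSuc natLeq)"
  using cardSuc_Card_order[OF natLeq_Card_order] card_order_on_well_order_on by blast

instantiation omega1 :: wellorder
begin

definition less_eq_omega1 :: "omega1 \<Rightarrow> omega1 \<Rightarrow> bool" where
  "a \<le> b \<longleftrightarrow> (Rep_omega1 a, Rep_omega1 b) \<in> cardSuc natLeq"

definition less_omega1 :: "omega1 \<Rightarrow> omega1 \<Rightarrow> bool" where
  "a < b \<longleftrightarrow> a \<le> b \<and> a \<noteq> (b :: omega1)"

instance
proof
  let ?r = "cardSuc natLeq"
  have lin: "linear_order_on (Field ?r) ?r" and wf: "wf (?r - Id)"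
    using omega1_well_order by (auto simp: well_order_on_def)
  have refl: "refl_on (Field ?r) ?r" and trans: "trans ?r" and anti: "antisym ?r"
    and tot: "total_on (Field ?r) ?r"
    using lin by (auto simp: order_on_defs)
  show le_refl: "a \<le> a" for a :: omega1
    using refl Rep_omega1[of a] by (auto simp: less_eq_omega1_def refl_on_def)
  show le_trans: "a \<le> b \<Longrightarrow> b \<le> c \<Longrightarrow> a \<le> c" for a b c :: omega1
    unfolding less_eq_omega1_def using trans by (meson transD)
  show le_anti: "a \<le> b \<Longrightarrow> b \<le> a \<Longrightarrow> a = b" for a b :: omega1
    unfolding less_eq_omega1_def using anti by (meson antisymD Rep_omega1_inject)
  show "a < b \<longleftrightarrow> a \<le> b \<and> \<not> b \<le> a" for a b :: omega1
    using le_anti le_refl by (auto simp: less_omega1_def)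
  show "a \<le> b \<or> b \<le> a" for a b :: omega1
    using tot Rep_omega1[of a] Rep_omega1[of b] le_refl[of a]
    by (cases "a = b") (auto simp: less_eq_omega1_def total_on_def Rep_omega1_inject)
  show "P a" if step: "\<And>x. (\<And>y. y < x \<Longrightarrow> P y) \<Longrightarrow> P x" for P and a :: omega1
  proof -
    have "wf (inv_image (?r - Id) Rep_omega1)"
      using wf by (rule wf_inv_image)
    then show "P a"
    proof (induction a rule: wf_induct_rule)
      case (less x)
      show ?case
        by (rule step, rule less.IH)
          (auto simp: less_omega1_def less_eq_omega1_def Rep_omega1_inject)
    qed
  qed
qed

end

lemma uncountable_omega1: "uncountable (UNIV :: omega1 set)"
proof
  include cardinal_syntax
  assume "countable (UNIV :: omega1 set)"
  then have "countable (Field (cardSuc natLeq))"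
    using type_definition.Rep_range[OF type_definition_omega1] by (metis countable_image)
  then have "|Field (cardSuc natLeq)| \<le>o |UNIV :: nat set|"
    unfolding countable_def by (meson card_of_ordLeqI subset_UNIV UNIV_I)
  then have "cardSuc natLeq \<le>o natLeq"
    using card_of_Field_ordIso[OF cardSuc_Card_order[OF natLeq_Card_order]] card_of_nat
    by (meson ordIso_ordLeq_trans ordIso_symmetric ordLeq_ordIso_trans)
  then show False
    using cardSuc_greater[OF natLeq_Card_order] not_ordLess_ordLeq by blast
qed

lemma countable_initial_omega1: "countable {..<a :: omega1}"
proof -
  include cardinal_syntax
  let ?r = "cardSuc natLeq"
  have sub: "Rep_omega1 ` {..<a} \<subseteq> underS ?r (Rep_omega1 a)"
    by (auto simp: underS_def less_omega1_def less_eq_omega1_def Rep_omega1_inject)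
  have "|underS ?r (Rep_omega1 a)| <o ?r"
    by (rule card_of_underS[OF cardSuc_Card_order[OF natLeq_Card_order] Rep_omega1])
  then have "|underS ?r (Rep_omega1 a)| \<le>o natLeq"
    using cardSuc_ordLess_ordLeq[OF natLeq_Card_order, of "|underS ?r (Rep_omega1 a)|"]
      cardSuc_ordLeq_ordLess[OF natLeq_Card_order card_of_Card_order] by blast
  then have "|underS ?r (Rep_omega1 a)| \<le>o |UNIV :: nat set|"
    using card_of_nat ordIso_symmetric ordLeq_ordIso_trans by blast
  then have "countable (underS ?r (Rep_omega1 a))"
    unfolding countable_def card_of_ordLeq[symmetric] by blast
  then have "countable (Rep_omega1 ` {..<a})"
    using sub countable_subset by blast
  then show ?thesis
    by (rule countable_image_inj_on) (auto simp: inj_on_def Rep_omega1_inject)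
qed

lemma omega1_no_max: "\<exists>b. a < (b :: omega1)"
proof (rule ccontr)
  assume "\<nexists>b. a < b"
  then have "UNIV = insert a {..<a}" by (auto simp: not_less order_le_less)
  then show False using uncountable_omega1 countable_initial_omega1[of a]
    by (metis countable_insert)
qed

definition osucc :: "omega1 \<Rightarrow> omega1" where
  "osucc \<alpha> = (LEAST \<beta>. \<alpha> < \<beta>)"


section \<open>Construction schemes\<close>

text \<open>A type \<open>\<langle>m\<^sub>k, n\<^sub>k\<^sub>+\<^sub>1, r\<^sub>k\<^sub>+\<^sub>1\<rangle>\<close> is given by three sequences; the values \<open>n 0\<close> and \<open>r 0\<close>
  carry no meaning and are never used.\<close>

definition scheme_type :: "(nat \<Rightarrow> nat) \<Rightarrow> (nat \<Rightarrow> nat) \<Rightarrow> (nat \<Rightarrow> nat) \<Rightarrow> bool" where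
  "scheme_type m n r \<longleftrightarrow> m 0 = 1 \<and>
     (\<forall>k. n (Suc k) \<ge> 2 \<and> r (Suc k) < m k \<and>
          m (Suc k) = r (Suc k) + (m k - r (Suc k)) * n (Suc k))"

definition good_type :: "(nat \<Rightarrow> nat) \<Rightarrow> (nat \<Rightarrow> nat) \<Rightarrow> (nat \<Rightarrow> nat) \<Rightarrow> bool" where
  "good_type m n r \<longleftrightarrow> scheme_type m n r \<and> (\<forall>s. infinite {k. r (Suc k) = s})"

definition level :: "(nat \<Rightarrow> nat) \<Rightarrow> omega1 set set \<Rightarrow> nat \<Rightarrow> omega1 set set" where
  "level m \<F> k = {F \<in> \<F>. card F = m k}"

definition initial_segment :: "omega1 set \<Rightarrow> omega1 set \<Rightarrow> bool" where
  "initial_segment A B \<longleftrightarrow> A \<subseteq> B \<and> (\<forall>x\<in>A. \<forall>y\<in>B. y \<le> x \<longrightarrow> y \<in> A)"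

definition set_less :: "omega1 set \<Rightarrow> omega1 set \<Rightarrow> bool" where
  "set_less A B \<longleftrightarrow> (\<forall>x\<in>A. \<forall>y\<in>B. x < y)"

text \<open>The list \<open>Fs\<close> is \<open>F\<^sub>0, \<dots>, F\<^sub>n\<^sub>-\<^sub>1\<close> and \<open>R\<close> is the root, for \<open>F\<close> in level \<open>Suc k\<close>.
  The chain of inequalities is spelled out between consecutive terms; the sets
  \<open>F\<^sub>i - R\<close> are never empty because \<open>r\<^sub>k\<^sub>+\<^sub>1 < m\<^sub>k\<close>.\<close>

definition decomposition ::
  "(nat \<Rightarrow> nat) \<Rightarrow> (nat \<Rightarrow> nat) \<Rightarrow> (nat \<Rightarrow> nat) \<Rightarrow> omega1 set set \<Rightarrow> nat \<Rightarrow>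
   omega1 set \<Rightarrow> omega1 set \<Rightarrow> omega1 set list \<Rightarrow> bool" where
  "decomposition m n r \<F> k F R Fs \<longleftrightarrow>
     length Fs = n (Suc k) \<and> set Fs \<subseteq> level m \<F> k \<and> F = \<Union>(set Fs) \<and>
     (\<forall>i<length Fs. \<forall>j<length Fs. i \<noteq> j \<longrightarrow> Fs ! i \<inter> Fs ! j = R) \<and>
     card R = r (Suc k) \<and>
     set_less R (Fs ! 0 - R) \<and>
     (\<forall>i. Suc i < length Fs \<longrightarrow> set_less (Fs ! i - R) (Fs ! Suc i - R))"

definition construction_scheme ::
  "(nat \<Rightarrow> nat) \<Rightarrow> (nat \<Rightarrow> nat) \<Rightarrow> (nat \<Rightarrow> nat) \<Rightarrow> omega1 set set \<Rightarrow> bool" where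
  "construction_scheme m n r \<F> \<longleftrightarrow>
     good_type m n r \<and>
     (\<forall>F\<in>\<F>. finite F \<and> F \<noteq> {} \<and> (\<exists>k. card F = m k)) \<and>
     (\<forall>A. finite A \<longrightarrow> (\<exists>F\<in>\<F>. A \<subseteq> F)) \<and>
     (\<forall>k. \<forall>E\<in>level m \<F> k. \<forall>F\<in>level m \<F> k.
        initial_segment (E \<inter> F) E \<and> initial_segment (E \<inter> F) F) \<and>
     (\<forall>k. \<forall>F\<in>level m \<F> (Suc k). \<exists>R Fs. decomposition m n r \<F> k F R Fs)"

definition two_construction_scheme ::
  "(nat \<Rightarrow> nat) \<Rightarrow> (nat \<Rightarrow> nat) \<Rightarrow> (nat \<Rightarrow> nat) \<Rightarrow> omega1 set set \<Rightarrow> bool" where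
  "two_construction_scheme m n r \<F> \<longleftrightarrow>
     construction_scheme m n r \<F> \<and> (\<forall>k. n (Suc k) = 2)"

text \<open>The root and the pieces of \<open>F\<close> in level \<open>Suc k\<close>. In a construction scheme they are
  determined by \<open>F\<close>: \<open>R(F)\<close> consists of the first \<open>r\<^sub>k\<^sub>+\<^sub>1\<close> elements of \<open>F\<close>, and the sets
  \<open>F\<^sub>i - R(F)\<close> are the successive blocks of length \<open>m\<^sub>k - r\<^sub>k\<^sub>+\<^sub>1\<close> after it.\<close>

definition root_of ::
  "(nat \<Rightarrow> nat) \<Rightarrow> (nat \<Rightarrow> nat) \<Rightarrow> (nat \<Rightarrow> nat) \<Rightarrow> omega1 set set \<Rightarrow> nat \<Rightarrow>
   omega1 set \<Rightarrow> omega1 set" where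
  "root_of m n r \<F> k F = (THE R. \<exists>Fs. decomposition m n r \<F> k F R Fs)"

definition pieces_of ::
  "(nat \<Rightarrow> nat) \<Rightarrow> (nat \<Rightarrow> nat) \<Rightarrow> (nat \<Rightarrow> nat) \<Rightarrow> omega1 set set \<Rightarrow> nat \<Rightarrow>
   omega1 set \<Rightarrow> omega1 set list" where
  "pieces_of m n r \<F> k F = (THE Fs. \<exists>R. decomposition m n r \<F> k F R Fs)"

text \<open>\<open>Xi m n r \<F> \<alpha> k\<close> is \<open>\<Xi>\<^sub>\<alpha>(k)\<close>; the value does not depend on the chosen \<open>F\<close>.\<close>

fun Xi ::
  "(nat \<Rightarrow> nat) \<Rightarrow> (nat \<Rightarrow> nat) \<Rightarrow> (nat \<Rightarrow> nat) \<Rightarrow> omega1 set set \<Rightarrow>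
   omega1 \<Rightarrow> nat \<Rightarrow> int" where
  "Xi m n r \<F> \<alpha> 0 = 0"
| "Xi m n r \<F> \<alpha> (Suc k) =
     (let F = (SOME F. F \<in> level m \<F> (Suc k) \<and> \<alpha> \<in> F);
          R = root_of m n r \<F> k F;
          Fs = pieces_of m n r \<F> k F
      in if \<alpha> \<in> R then -1
         else int (THE i. i < length Fs \<and> \<alpha> \<in> Fs ! i - R))"


section \<open>The gap\<close>

definition L_gap ::
  "(nat \<Rightarrow> nat) \<Rightarrow> (nat \<Rightarrow> nat) \<Rightarrow> (nat \<Rightarrow> nat) \<Rightarrow> omega1 set set \<Rightarrow>
   omega1 \<Rightarrow> nat set" where
  "L_gap m n r \<F> \<alpha> =
     {x. \<exists>k\<ge>1. Xi m n r \<F> \<alpha> k \<ge> 0 \<and> int x = 2 * int k + Xi m n r \<F> \<alpha> k}"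

definition R_gap ::
  "(nat \<Rightarrow> nat) \<Rightarrow> (nat \<Rightarrow> nat) \<Rightarrow> (nat \<Rightarrow> nat) \<Rightarrow> omega1 set set \<Rightarrow>
   omega1 \<Rightarrow> nat set" where
  "R_gap m n r \<F> \<alpha> =
     {x. \<exists>k\<ge>1. Xi m n r \<F> \<alpha> k \<ge> 0 \<and> int x = 2 * int k + (1 - Xi m n r \<F> \<alpha> k)}"

definition separates :: "nat set \<Rightarrow> (omega1 \<Rightarrow> nat set) \<Rightarrow> (omega1 \<Rightarrow> nat set) \<Rightarrow> bool" where
  "separates C A B \<longleftrightarrow> (\<forall>\<alpha>. finite (A \<alpha> - C) \<and> finite (C \<inter> B \<alpha>))"

definition levelwise_separable :: "(omega1 \<Rightarrow> nat set) \<Rightarrow> (omega1 \<Rightarrow> nat set) \<Rightarrow> bool" where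
  "levelwise_separable A B \<longleftrightarrow>
     (\<exists>C. separates C (\<lambda>\<alpha>. A (osucc \<alpha>) - A \<alpha>) (\<lambda>\<alpha>. B (osucc \<alpha>) - B \<alpha>))"

end

(* The set of even numbers separates. Let \<beta> = \<alpha> + 1 and let l be a level at which some
   member of the scheme contains both \<alpha> and \<beta>. From level l on, every member containing \<beta> also
   contains \<alpha>, so if F has level above l and \<beta> is in F_1 - R(F), then \<alpha> is in F_1; it cannot be
   in R(F), because the nonempty set F_0 - R(F) would lie strictly between \<alpha> and \<beta>. Hence for
   almost all k either \<Xi>_\<alpha>(k) = \<Xi>_\<beta>(k), or \<Xi>_\<beta>(k) = -1, or \<Xi>_\<beta>(k) = 0. Only in the last case
   does k contribute to the difference sets, namely 2k on the left and 2k + 1 on the right. *)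
theory Submission
  imports Defs
begin

section \<open>Initial segments and ranks in finite sets of ordinals\<close>

text \<open>A point of \<open>I\<close> has all its predecessors in \<open>I\<close> and is not
  among them, while a point of \<open>F\<close> outside \<open>I\<close> lies above all of
  \<open>I\<close>. So an initial segment is recovered from its size alone.\<close>

lemma initial_segment_eq_rank_less:
  assumes "finite F" "initial_segment I F"
  shows "I = {x \<in> F. card {y \<in> F. y < x} < card I}"
proof -
  have sub: "I \<subseteq> F" using assms(2) by (simp add: initial_segment_def)
  have fin: "finite I" using sub assms(1) finite_subset by blast
  have "card {y \<in> F. y < x} < card I" if "x \<in> I" for x
  proof (rule psubset_card_mono[OF fin])
    show "{y \<in> F. y < x} \<subset> I"
      using that assms(2) by (auto simp: initial_segment_def)
  qed
  moreover have "card I \<le> card {y \<in> F. y < x}" if "x \<in> F" "x \<notin> I" for x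
  proof (rule card_mono)
    show "finite {y \<in> F. y < x}" using assms(1) by simp
    show "I \<subseteq> {y \<in> F. y < x}"
      using that sub assms(2) by (fastforce simp: initial_segment_def not_less[symmetric])
  qed
  ultimately show ?thesis using sub by (fastforce simp: not_less[symmetric])
qed

text \<open>Since \<open>x\<close> lies in the intersection, so does every predecessor of
  \<open>x\<close> in either set. This is the source of the independence of \<Xi> from the chosen
  member.\<close>

lemma rank_eq_if_initial_segment_Int:
  assumes "initial_segment (E \<inter> F) E" "initial_segment (E \<inter> F) F" "x \<in> E" "x \<in> F"
  shows "{y \<in> E. y < x} = {y \<in> F. y < x}"
proof -
  have "y \<in> E \<longleftrightarrow> y \<in> F" if "y < x" for y
    using assms that less_imp_le[OF that] unfolding initial_segment_def by (metis IntD1 IntD2 IntI)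
  then show ?thesis by blast
qed

lemma finite_indexed:
  fixes f :: "nat \<Rightarrow> int"
  shows "finite {x. \<exists>k\<le>K. int x = f k}"
proof (rule finite_subset)
  show "{x. \<exists>k\<le>K. int x = f k} \<subseteq> (\<lambda>k. nat (f k)) ` {..K}"
  proof
    fix x assume "x \<in> {x. \<exists>k\<le>K. int x = f k}"
    then obtain k where "k \<le> K" "int x = f k" by blast
    then show "x \<in> (\<lambda>k. nat (f k)) ` {..K}" by (metis atMost_iff imageI nat_int)
  qed
qed simp

lemma less_osucc: "\<alpha> < osucc \<alpha>"
  unfolding osucc_def using omega1_no_max[of \<alpha>] by (metis LeastI)

lemma osucc_le: "\<alpha> < \<beta> \<Longrightarrow> osucc \<alpha> \<le> \<beta>"
  unfolding osucc_def by (rule Least_le)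

section \<open>Decompositions in a 2-construction scheme\<close>

locale two_scheme =
  fixes m n r :: "nat \<Rightarrow> nat" and \<F> :: "omega1 set set"
  assumes two: "two_construction_scheme m n r \<F>"
begin

lemma scheme: "construction_scheme m n r \<F>"
  and n_Suc [simp]: "n (Suc k) = 2"
  using two by (auto simp: two_construction_scheme_def)

lemma r_less: "r (Suc k) < m k"
  and m_Suc: "m (Suc k) = r (Suc k) + (m k - r (Suc k)) * 2"
  using scheme n_Suc
  by (auto simp: construction_scheme_def good_type_def scheme_type_def)

lemma strict_mono_m: "strict_mono m"
  unfolding strict_mono_Suc_iff
proof
  fix k show "m k < m (Suc k)" using r_less[of k] m_Suc[of k] by linarith
qed

lemma finite_level: "F \<in> level m \<F> k \<Longrightarrow> finite F"
  using scheme by (auto simp: construction_scheme_def level_def)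

lemma card_level: "F \<in> level m \<F> k \<Longrightarrow> card F = m k"
  by (simp add: level_def)

lemma level_Int:
  assumes "E \<in> level m \<F> k" "F \<in> level m \<F> k"
  shows "initial_segment (E \<inter> F) E" "initial_segment (E \<inter> F) F"
  using scheme assms by (auto simp: construction_scheme_def)

lemma decomposition_exists:
  assumes "F \<in> level m \<F> (Suc k)"
  obtains R Fs where "decomposition m n r \<F> k F R Fs"
  using scheme assms unfolding construction_scheme_def by blast

lemma decomposition_two:
  assumes "decomposition m n r \<F> k F R Fs"
  obtains F0 F1 where "Fs = [F0, F1]" "F0 \<in> level m \<F> k" "F1 \<in> level m \<F> k"
    "F = F0 \<union> F1" "F0 \<inter> F1 = R" "card R = r (Suc k)"
    "set_less R (F0 - R)" "set_less (F0 - R) (F1 - R)" "F0 - R \<noteq> {}"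
    "initial_segment R F" "initial_segment F0 F"
proof -
  have "length Fs = 2" using assms by (simp add: decomposition_def)
  then obtain F0 F1 where Fs: "Fs = [F0, F1]"
    by (auto simp: numeral_2_eq_2 length_Suc_conv)
  have lev: "F0 \<in> level m \<F> k" "F1 \<in> level m \<F> k" and F: "F = F0 \<union> F1"
    and cR: "card R = r (Suc k)" and less0: "set_less R (F0 - R)"
    and less1: "set_less (F0 - R) (F1 - R)"
    using assms by (auto simp: decomposition_def Fs)
  have "\<forall>i<length Fs. \<forall>j<length Fs. i \<noteq> j \<longrightarrow> Fs ! i \<inter> Fs ! j = R"
    using assms unfolding decomposition_def by blast
  from this[rule_format, of 0 1] have "Fs ! 0 \<inter> Fs ! 1 = R" by (simp add: Fs)
  then have R: "F0 \<inter> F1 = R" by (simp add: Fs)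
  \<comment> \<open>\<open>F0\<close> has \<open>m k\<close> elements and \<open>R\<close> only
    \<open>r (Suc k)\<close>, which is fewer. The resulting point \<open>z\<close> links
    \<open>R\<close> to \<open>F1 - R\<close>, as the definition compares only consecutive
    blocks.\<close>
  have "\<not> F0 \<subseteq> R"
    using card_mono[of R F0] cR card_level[OF lev(1)] r_less[of k] finite_level[OF lev(1)] R
    by fastforce
  then obtain z where z: "z \<in> F0" "z \<notin> R" by blast
  have less2: "set_less R (F1 - R)"
    using z less0 less1 unfolding set_less_def by (meson DiffI less_trans)
  have "initial_segment R F"
    unfolding initial_segment_def F using R less0 less2
    by (fastforce simp: set_less_def not_less[symmetric])
  moreover have "initial_segment F0 F"
    unfolding initial_segment_def F using R less1 less2
    by (fastforce simp: set_less_def not_less[symmetric])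
  ultimately show thesis
    using that[OF Fs lev F R cR less0 less1] z by blast
qed

text \<open>Root and first piece are initial segments of \<open>F\<close> of the prescribed sizes
  \<open>r (Suc k)\<close> and \<open>m k\<close>, hence cut out by rank. The second piece is then
  what remains, together with the root.\<close>

lemma decomposition_rank:
  assumes "F \<in> level m \<F> (Suc k)" "decomposition m n r \<F> k F R Fs"
  shows "R = {x \<in> F. card {y \<in> F. y < x} < r (Suc k)}"
    and "Fs ! 0 = {x \<in> F. card {y \<in> F. y < x} < m k}"
    and "Fs = [Fs ! 0, R \<union> (F - Fs ! 0)]"
proof -
  obtain F0 F1 where D: "Fs = [F0, F1]" "F0 \<in> level m \<F> k"
    "F = F0 \<union> F1" "F0 \<inter> F1 = R" "card R = r (Suc k)"
    "initial_segment R F" "initial_segment F0 F"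
    using decomposition_two[OF assms(2)] by metis
  have fin: "finite F" using finite_level assms(1) .
  show "R = {x \<in> F. card {y \<in> F. y < x} < r (Suc k)}"
    using initial_segment_eq_rank_less[OF fin D(6)] D(5) by simp
  show "Fs ! 0 = {x \<in> F. card {y \<in> F. y < x} < m k}"
    using initial_segment_eq_rank_less[OF fin D(7)] D(1) card_level[OF D(2)] by simp
  show "Fs = [Fs ! 0, R \<union> (F - Fs ! 0)]"
    using D(1,3,4) by auto
qed

text \<open>Ranks in \<open>F\<close> do not refer to the decomposition. Uniqueness gives meaning to
  the definite descriptions in \<open>root_of\<close> and \<open>pieces_of\<close>.\<close>

lemma decomposition_unique:
  assumes "F \<in> level m \<F> (Suc k)"
    "decomposition m n r \<F> k F R Fs" "decomposition m n r \<F> k F R' Fs'"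
  shows "R' = R" "Fs' = Fs"
proof -
  show "R' = R"
    using decomposition_rank(1)[OF assms(1,2)] decomposition_rank(1)[OF assms(1,3)] by simp
  moreover have "Fs' ! 0 = Fs ! 0"
    using decomposition_rank(2)[OF assms(1,2)] decomposition_rank(2)[OF assms(1,3)] by simp
  ultimately show "Fs' = Fs"
    using decomposition_rank(3)[OF assms(1,2)] decomposition_rank(3)[OF assms(1,3)] by simp
qed

lemma root_of_eq:
  assumes "F \<in> level m \<F> (Suc k)" "decomposition m n r \<F> k F R Fs"
  shows "root_of m n r \<F> k F = R"
  unfolding root_of_def
  using assms decomposition_unique(1)[OF assms] by (intro the_equality) blast+

lemma pieces_of_eq:
  assumes "F \<in> level m \<F> (Suc k)" "decomposition m n r \<F> k F R Fs"
  shows "pieces_of m n r \<F> k F = Fs"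
  unfolding pieces_of_def
  using assms decomposition_unique(2)[OF assms] by (intro the_equality) blast+

section \<open>Passing from a level to lower ones\<close>

lemma piece_exists:
  assumes "F \<in> level m \<F> (Suc k)" "\<beta> \<in> F"
  obtains G where "G \<in> level m \<F> k" "G \<subseteq> F" "\<beta> \<in> G"
proof -
  obtain R Fs where "decomposition m n r \<F> k F R Fs"
    using decomposition_exists assms(1) .
  then obtain F0 F1 where "F0 \<in> level m \<F> k" "F1 \<in> level m \<F> k" "F = F0 \<union> F1"
    using decomposition_two by metis
  with that assms(2) show thesis by blast
qed

text \<open>Adding \<open>m k\<close> points to \<open>\<beta>\<close> forces a covering member to
  have level \<open>j\<close> at least \<open>k\<close>. Downward induction through pieces
  containing \<open>\<beta>\<close> then reaches level \<open>k\<close>.\<close>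

lemma level_covers: "\<exists>F \<in> level m \<F> k. \<beta> \<in> F"
proof -
  have "infinite (UNIV :: omega1 set)"
    using uncountable_omega1 uncountable_infinite by blast
  then obtain A :: "omega1 set" where A: "finite A" "card A = m k"
    using infinite_arbitrarily_large by blast
  obtain F where F: "F \<in> \<F>" "insert \<beta> A \<subseteq> F"
    using scheme A(1) unfolding construction_scheme_def by (meson finite_insert)
  obtain j where j: "finite F" "card F = m j"
    using scheme F(1) unfolding construction_scheme_def by blast
  have "m k \<le> m j"
    using card_mono[OF j(1), of A] F(2) A(2) j(2) by simp
  then have "k \<le> j"
    using strict_mono_m by (simp add: strict_mono_less_eq)
  moreover have "\<exists>F \<in> level m \<F> j. \<beta> \<in> F"
    using F j(2) by (auto simp: level_def)
  ultimately show ?thesis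
  proof (induction rule: inc_induct)
    case (step i)
    then show ?case using piece_exists by metis
  qed
qed

section \<open>Evaluating \<Xi> on an arbitrary member\<close>

text \<open>The rank of \<open>\<beta>\<close> is the same in all members of the level that contain
  it, and this rank decides membership in the root and in the first piece.\<close>

lemma Xi_Suc:
  assumes F: "F \<in> level m \<F> (Suc k)" "\<beta> \<in> F" and dec: "decomposition m n r \<F> k F R Fs"
  shows "Xi m n r \<F> \<beta> (Suc k) = (if \<beta> \<in> R then -1 else if \<beta> \<in> Fs ! 0 then 0 else 1)"
proof -
  \<comment> \<open>\<open>G\<close> is the member selected in the definition of \<open>Xi\<close>;
    it may differ from \<open>F\<close>.\<close>
  define G where "G = (SOME F. F \<in> level m \<F> (Suc k) \<and> \<beta> \<in> F)"
  have G: "G \<in> level m \<F> (Suc k)" "\<beta> \<in> G"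
    using F someI_ex[of "\<lambda>F. F \<in> level m \<F> (Suc k) \<and> \<beta> \<in> F"] unfolding G_def by blast+
  obtain Q Gs where Q: "decomposition m n r \<F> k G Q Gs"
    using decomposition_exists G(1) .
  obtain G0 G1 where D: "Gs = [G0, G1]" "G = G0 \<union> G1" "G0 \<inter> G1 = Q"
    using decomposition_two[OF Q] by metis
  have "{y \<in> F. y < \<beta>} = {y \<in> G. y < \<beta>}"
    using rank_eq_if_initial_segment_Int level_Int F G by blast
  then have R_iff: "\<beta> \<in> R \<longleftrightarrow> \<beta> \<in> Q" and F0_iff: "\<beta> \<in> Fs ! 0 \<longleftrightarrow> \<beta> \<in> Gs ! 0"
    using decomposition_rank(1,2)[OF F(1) dec] decomposition_rank(1,2)[OF G(1) Q] F(2) G(2)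
    by auto
  have "Xi m n r \<F> \<beta> (Suc k) =
      (if \<beta> \<in> Q then -1 else int (THE i. i < length Gs \<and> \<beta> \<in> Gs ! i - Q))"
    unfolding Xi.simps Let_def G_def[symmetric] root_of_eq[OF G(1) Q] pieces_of_eq[OF G(1) Q] ..
  also have "\<dots> = (if \<beta> \<in> Q then -1 else if \<beta> \<in> G0 then 0 else 1)"
  proof -
    have "(THE i. i < length Gs \<and> \<beta> \<in> Gs ! i - Q) = (if \<beta> \<in> G0 then 0 else 1)"
      if "\<beta> \<notin> Q"
    proof (rule the_equality)
      show "(if \<beta> \<in> G0 then 0 else 1) < length Gs \<and> \<beta> \<in> Gs ! (if \<beta> \<in> G0 then 0 else 1) - Q"
        using that D(2) G(2) by (auto simp: D(1))
      show "i = (if \<beta> \<in> G0 then 0 else 1)" if i: "i < length Gs \<and> \<beta> \<in> Gs ! i - Q" for i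
      proof -
        have "i = 0 \<or> i = 1" using i by (auto simp: D(1))
        then show ?thesis using i D(3) by (auto simp: D(1))
      qed
    qed
    then show ?thesis by (cases "\<beta> \<in> Q") simp_all
  qed
  finally show ?thesis unfolding R_iff F0_iff D(1) nth_Cons_0 .
qed

section \<open>Consecutive ordinals at high levels\<close>

text \<open>At level \<open>l\<close> the set \<open>E \<inter> F\<close> is an initial segment of
  \<open>E\<close> containing \<open>\<beta>\<close>, hence also \<open>\<alpha>\<close>. Higher up,
  the claim is inherited from a piece of \<open>F\<close> containing \<open>\<beta>\<close>.\<close>

lemma level_absorbs:
  assumes "E \<in> level m \<F> l" "\<alpha> \<in> E" "\<beta> \<in> E" "\<alpha> \<le> \<beta>" "l \<le> k"
    and "F \<in> level m \<F> k" "\<beta> \<in> F"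
  shows "\<alpha> \<in> F"
  using assms(5-7)
proof (induction arbitrary: F rule: dec_induct)
  case base
  have "\<beta> \<in> E \<inter> F" using base(2) assms(3) by (rule IntI[rotated])
  moreover have "initial_segment (E \<inter> F) E" using assms(1) base(1) by (rule level_Int(1))
  ultimately have "\<alpha> \<in> E \<inter> F"
    using assms(2,4) by (simp add: initial_segment_def)
  then show ?case by (rule IntD2)
next
  case (step i)
  obtain G where "G \<in> level m \<F> i" "G \<subseteq> F" "\<beta> \<in> G"
    by (rule piece_exists[OF step.prems])
  then show ?case using step.IH[of G] by (simp add: subset_eq)
qed

lemma Xi_osucc:
  "\<exists>K. \<forall>k>K. Xi m n r \<F> (osucc \<alpha>) k \<in> {-1, 0, Xi m n r \<F> \<alpha> k}"
proof -
  obtain E where E: "E \<in> \<F>" "{\<alpha>, osucc \<alpha>} \<subseteq> E"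
    using scheme unfolding construction_scheme_def by (meson finite.emptyI finite.insertI)
  obtain K where "card E = m K"
    using scheme E(1) unfolding construction_scheme_def by blast
  with E have absorb: "\<alpha> \<in> F" if "K \<le> k" "F \<in> level m \<F> k" "osucc \<alpha> \<in> F" for k F
    using level_absorbs[of E K \<alpha> "osucc \<alpha>" k F] that less_osucc[of \<alpha>] by (auto simp: level_def)
  show ?thesis
  proof (intro exI[of _ K] allI impI)
    \<comment> \<open>The strict inequality is needed so that absorption also applies to the pieces
      of \<open>F\<close>, which live one level lower, at \<open>j\<close>.\<close>
    fix k assume "K < k"
    then obtain j where k: "k = Suc j" "K \<le> j" by (cases k) auto
    obtain F where F: "F \<in> level m \<F> (Suc j)" "osucc \<alpha> \<in> F"
      using level_covers by blast
    \<comment> \<open>Both ordinals can thus be evaluated with the same member and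
      decomposition.\<close>
    have \<alpha>F: "\<alpha> \<in> F" using absorb[OF _ F] k(2) by simp
    obtain R Fs where dec: "decomposition m n r \<F> j F R Fs"
      using decomposition_exists F(1) .
    obtain F0 F1 where D: "Fs = [F0, F1]" "F1 \<in> level m \<F> j"
      "F = F0 \<union> F1" "F0 \<inter> F1 = R" "set_less R (F0 - R)" "set_less (F0 - R) (F1 - R)"
      "F0 - R \<noteq> {}"
      using decomposition_two[OF dec] by metis
    \<comment> \<open>Only the value 1 at \<open>osucc \<alpha>\<close> needs work, since -1 and 0
      are allowed outright.\<close>
    have "Xi m n r \<F> \<alpha> (Suc j) = 1" if "osucc \<alpha> \<notin> R" "osucc \<alpha> \<notin> F0"
    proof -
      have \<beta>: "osucc \<alpha> \<in> F1" using that F(2) D(3) by blast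
      have \<alpha>: "\<alpha> \<in> F1" using absorb[OF k(2) D(2) \<beta>] .
      have "\<alpha> \<notin> R"
      proof
        assume "\<alpha> \<in> R"
        obtain z where z: "z \<in> F0 - R" using D(7) by blast
        have "\<alpha> < z" using D(5) \<open>\<alpha> \<in> R\<close> z by (auto simp: set_less_def)
        moreover have "z < osucc \<alpha>" using D(6) \<beta> that(1) z by (auto simp: set_less_def)
        ultimately show False using osucc_le[of \<alpha> z] by simp
      qed
      \<comment> \<open>As \<open>F0 \<inter> F1 = R\<close>, a point of \<open>F1\<close> outside
        \<open>R\<close> is not in \<open>F0\<close>.\<close>
      then show ?thesis using Xi_Suc[OF F(1) \<alpha>F dec] \<alpha> D(1,4) by (auto simp del: Xi.simps)
    qed
    then show "Xi m n r \<F> (osucc \<alpha>) k \<in> {-1, 0, Xi m n r \<F> \<alpha> k}"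
      using Xi_Suc[OF F dec] D(1) by (auto simp: k(1) simp del: Xi.simps)
  qed
qed

section \<open>Separation by the even numbers\<close>

lemma evens_separate:
  "separates {x. even x} (\<lambda>\<alpha>. L_gap m n r \<F> (osucc \<alpha>) - L_gap m n r \<F> \<alpha>)
    (\<lambda>\<alpha>. R_gap m n r \<F> (osucc \<alpha>) - R_gap m n r \<F> \<alpha>)"
  unfolding separates_def
proof (intro allI conjI)
  fix \<alpha>
  let ?\<beta> = "osucc \<alpha>"
  obtain K where K: "\<forall>k>K. Xi m n r \<F> ?\<beta> k \<in> {-1, 0, Xi m n r \<F> \<alpha> k}"
    using Xi_osucc[of \<alpha>] by (elim exE)
  show "finite (L_gap m n r \<F> ?\<beta> - L_gap m n r \<F> \<alpha> - {x. even x})"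
  proof (rule finite_subset[OF subsetI])
    fix x assume x: "x \<in> L_gap m n r \<F> ?\<beta> - L_gap m n r \<F> \<alpha> - {x. even x}"
    then obtain k where k: "k \<ge> 1" "Xi m n r \<F> ?\<beta> k \<ge> 0" "int x = 2 * int k + Xi m n r \<F> ?\<beta> k"
      unfolding L_gap_def by blast
    have "\<not> (Xi m n r \<F> \<alpha> k \<ge> 0 \<and> int x = 2 * int k + Xi m n r \<F> \<alpha> k)"
      using x k(1) unfolding L_gap_def by blast
    \<comment> \<open>With equal values, the same \<open>k\<close> would put \<open>x\<close> into
      the set of \<open>\<alpha>\<close>.\<close>
    then have "Xi m n r \<F> ?\<beta> k \<noteq> Xi m n r \<F> \<alpha> k" using k(2,3) by metis
    moreover have "Xi m n r \<F> ?\<beta> k \<noteq> 0"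
    proof
      assume "Xi m n r \<F> ?\<beta> k = 0"
      with k(3) have "even x" by presburger
      then show False using x by simp
    qed
    moreover have "Xi m n r \<F> ?\<beta> k \<noteq> -1" using k(2) by linarith
    \<comment> \<open>All three values possible beyond \<open>K\<close> are excluded. Each of the
      remaining finitely many \<open>k\<close> determines at most one \<open>x\<close>.\<close>
    ultimately have "k \<le> K" using K[rule_format, of k] not_less by blast
    with k(3) show "x \<in> {x. \<exists>k\<le>K. int x = 2 * int k + Xi m n r \<F> ?\<beta> k}" by blast
  qed (rule finite_indexed)
  show "finite ({x. even x} \<inter> (R_gap m n r \<F> ?\<beta> - R_gap m n r \<F> \<alpha>))"
  proof (rule finite_subset[OF subsetI])
    fix x assume x: "x \<in> {x. even x} \<inter> (R_gap m n r \<F> ?\<beta> - R_gap m n r \<F> \<alpha>)"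
    then obtain k where k: "k \<ge> 1" "Xi m n r \<F> ?\<beta> k \<ge> 0" "int x = 2 * int k + (1 - Xi m n r \<F> ?\<beta> k)"
      unfolding R_gap_def by blast
    have "\<not> (Xi m n r \<F> \<alpha> k \<ge> 0 \<and> int x = 2 * int k + (1 - Xi m n r \<F> \<alpha> k))"
      using x k(1) unfolding R_gap_def by blast
    then have "Xi m n r \<F> ?\<beta> k \<noteq> Xi m n r \<F> \<alpha> k" using k(2,3) by metis
    \<comment> \<open>On the right the value 0 yields 2k + 1, so here it is the evenness of
      \<open>x\<close> that rules it out.\<close>
    moreover have "Xi m n r \<F> ?\<beta> k \<noteq> 0"
    proof
      assume "Xi m n r \<F> ?\<beta> k = 0"
      with k(3) have "odd x" by presburger
      then show False using x by simp
    qed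
    moreover have "Xi m n r \<F> ?\<beta> k \<noteq> -1" using k(2) by linarith
    ultimately have "k \<le> K" using K[rule_format, of k] not_less by blast
    with k(3) show "x \<in> {x. \<exists>k\<le>K. int x = 2 * int k + (1 - Xi m n r \<F> ?\<beta> k)}" by blast
  qed (rule finite_indexed)
qed

end

theorem mainTheorem5:
  fixes m n r :: "nat \<Rightarrow> nat" and \<F> :: "omega1 set set"
  assumes "two_construction_scheme m n r \<F>"
  shows "levelwise_separable (L_gap m n r \<F>) (R_gap m n r \<F>)"
  unfolding levelwise_separable_def
  using two_scheme.evens_separate[OF two_scheme.intro[OF assms]] by blast

end
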